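(* Let $n\ge2$, let $\beta>0$, and let $\Omega$ be a bounded domain in $\mathbb{R}^n$ of class $C^2$, with outer unit normal $\nu$. If, for some $\lambda>0$, the problem $$\begin{cases}-\min\{|\nabla u|-\lambda u,\ \Delta_\infty u\}=0 & \text{in }\Omega,\\ \min\left\{|\nabla u|-\beta u,\ \dfrac{\partial u}{\partial\nu}\right\}=0 & \text{on }\partial\Omega\end{cases}$$ admits a nontrivial, positive eigenfunction $u$ (that is, a viscosity solution $u$, continuous on $\overline\Omega$, with $u>0$ in $\Omega$), then $\lambda=\beta$.
   Context: The infinity Laplacian is $\Delta_\infty u=\langle D^2u\,\nabla u,\nabla u\rangle$. Viscosity solutions. Consider the boundary value problem $F(x,u,\nabla u,D^2u)=0$ in $\Omega$, $G(x,u,\nabla u)=0$ on $\partial\Omega$, with $F,G$ continuous. (Here $F(x,r,\xi,X)=-\min\{|\xi|-\lambda r,\langle X\xi,\xi\rangle\}$ and $G(x,r,\xi)=\min\{|\xi|-\beta r,\ \xi\cdot\nu(x)\}$.) A lower semicontinuous function $u$ on $\overline\Omega$ is a viscosity supersolution if for every $x_0\in\overline\Omega$ and every $\phi\in C^2(\overline\Omega)$ such that $u(x_0)=\phi(x_0)$ and $u-\phi$ has a strict minimum at $x_0$: if $x_0\in\Omega$, then $F(x_0,\phi(x_0),\nabla\phi(x_0),D^2\phi(x_0))\ge0$; if $x_0\in\partial\Omega$, then $\max\{F(x_0,\phi(x_0),\nabla\phi(x_0),D^2\phi(x_0)),\,G(x_0,\phi(x_0),\nabla\phi(x_0))\}\ge0$.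 An upper semicontinuous function $u$ on $\overline\Omega$ is a viscosity subsolution if for every $x_0\in\overline\Omega$ and every $\phi\in C^2(\overline\Omega)$ such that $u(x_0)=\phi(x_0)$ and $u-\phi$ has a strict maximum at $x_0$: if $x_0\in\Omega$, then $F(x_0,\phi(x_0),\nabla\phi(x_0),D^2\phi(x_0))\le0$; if $x_0\in\partial\Omega$, then $\min\{F(x_0,\phi(x_0),\nabla\phi(x_0),D^2\phi(x_0)),\,G(x_0,\phi(x_0),\nabla\phi(x_0))\}\le0$. A continuous function on $\overline\Omega$ is a viscosity solution if it is both a viscosity supersolution and a viscosity subsolution. *)

theory Defs
  imports "HOL-Analysis.Analysis"
begin

text \<open>
  The space \<open>C\<^sup>2\<close> on the closure of an open set: \<open>\<phi>\<close> is twice continuously differentiable in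
  \<open>\<Omega>\<close>, and \<open>\<phi>\<close>, its gradient and its Hessian extend continuously to \<open>closure \<Omega>\<close>. The functions
  \<open>D\<phi>\<close> and \<open>D2\<phi>\<close> are the gradient and the Hessian; on \<open>frontier \<Omega>\<close> their values are those of the
  continuous extensions, hence uniquely determined by \<open>\<phi>\<close>.
\<close>

definition C2_closure ::
  "(real^'n) set \<Rightarrow> (real^'n \<Rightarrow> real) \<Rightarrow> (real^'n \<Rightarrow> real^'n) \<Rightarrow> (real^'n \<Rightarrow> real^'n^'n) \<Rightarrow> bool"
  where "C2_closure \<Omega> \<phi> D\<phi> D2\<phi> \<longleftrightarrow>
    (\<forall>x\<in>\<Omega>. GDERIV \<phi> x :> D\<phi> x) \<and>
    (\<forall>x\<in>\<Omega>. (D\<phi> has_derivative (\<lambda>h. D2\<phi> x *v h)) (at x)) \<and>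
    continuous_on (closure \<Omega>) \<phi> \<and>
    continuous_on (closure \<Omega>) D\<phi> \<and>
    continuous_on (closure \<Omega>) D2\<phi>"

text \<open>
  Boundary of class \<open>C\<^sup>2\<close>: near every boundary point, in suitable orthonormal coordinates, \<open>\<Omega>\<close> is
  the set above the graph of a \<open>C\<^sup>2\<close> function of \<open>n - 1\<close> variables. The unit vector \<open>e\<close> is the
  vertical direction; a function of the remaining \<open>n - 1\<close> coordinates is encoded as a function
  \<open>\<gamma>\<close> on the whole space that is invariant under translations along \<open>e\<close>.
\<close>

definition C2_boundary :: "(real^'n) set \<Rightarrow> bool"
  where "C2_boundary \<Omega> \<longleftrightarrow>
    (\<forall>x0\<in>frontier \<Omega>. \<exists>r>0. \<exists>e \<gamma> D\<gamma> D2\<gamma>.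
       norm e = 1 \<and>
       C2_closure UNIV \<gamma> D\<gamma> D2\<gamma> \<and>
       (\<forall>x t. \<gamma> (x + t *\<^sub>R e) = \<gamma> x) \<and>
       (\<forall>x\<in>ball x0 r. x \<in> \<Omega> \<longleftrightarrow> \<gamma> x < x \<bullet> e))"

text \<open>Tangent vectors are velocities of curves in the hypersurface.\<close>

definition tangent_vector :: "(real^'n) set \<Rightarrow> real^'n \<Rightarrow> real^'n \<Rightarrow> bool"
  where "tangent_vector S x w \<longleftrightarrow>
    (\<exists>c :: real \<Rightarrow> real^'n. c 0 = x \<and> (\<forall>\<^sub>F t in nhds 0. c t \<in> S) \<and>
       (c has_vector_derivative w) (at 0))"

definition outer_unit_normal :: "(real^'n) set \<Rightarrow> real^'n \<Rightarrow> real^'n \<Rightarrow> bool"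
  where "outer_unit_normal \<Omega> x v \<longleftrightarrow>
    norm v = 1 \<and>
    (\<forall>w. tangent_vector (frontier \<Omega>) x w \<longrightarrow> v \<bullet> w = 0) \<and>
    (\<forall>\<^sub>F t in at_right 0. x + t *\<^sub>R v \<notin> closure \<Omega>)"

definition lower_semicontinuous_on :: "'a::topological_space set \<Rightarrow> ('a \<Rightarrow> real) \<Rightarrow> bool"
  where "lower_semicontinuous_on S u \<longleftrightarrow>
    (\<forall>x\<in>S. \<forall>a<u x. \<forall>\<^sub>F y in at x within S. a < u y)"

definition upper_semicontinuous_on :: "'a::topological_space set \<Rightarrow> ('a \<Rightarrow> real) \<Rightarrow> bool"
  where "upper_semicontinuous_on S u \<longleftrightarrow>
    (\<forall>x\<in>S. \<forall>a>u x. \<forall>\<^sub>F y in at x within S. u y < a)"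

definition strict_min_at :: "'a set \<Rightarrow> ('a \<Rightarrow> real) \<Rightarrow> 'a \<Rightarrow> bool"
  where "strict_min_at S f x0 \<longleftrightarrow> x0 \<in> S \<and> (\<forall>x\<in>S - {x0}. f x0 < f x)"

definition strict_max_at :: "'a set \<Rightarrow> ('a \<Rightarrow> real) \<Rightarrow> 'a \<Rightarrow> bool"
  where "strict_max_at S f x0 \<longleftrightarrow> x0 \<in> S \<and> (\<forall>x\<in>S - {x0}. f x < f x0)"

definition viscosity_supersolution ::
  "(real^'n) set \<Rightarrow> (real^'n \<Rightarrow> real \<Rightarrow> real^'n \<Rightarrow> real^'n^'n \<Rightarrow> real) \<Rightarrow>
   (real^'n \<Rightarrow> real \<Rightarrow> real^'n \<Rightarrow> real) \<Rightarrow> (real^'n \<Rightarrow> real) \<Rightarrow> bool"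
  where "viscosity_supersolution \<Omega> F G u \<longleftrightarrow>
    lower_semicontinuous_on (closure \<Omega>) u \<and>
    (\<forall>x0\<in>closure \<Omega>. \<forall>\<phi> D\<phi> D2\<phi>.
       C2_closure \<Omega> \<phi> D\<phi> D2\<phi> \<and> u x0 = \<phi> x0 \<and> strict_min_at (closure \<Omega>) (\<lambda>x. u x - \<phi> x) x0 \<longrightarrow>
       (x0 \<in> \<Omega> \<longrightarrow> F x0 (\<phi> x0) (D\<phi> x0) (D2\<phi> x0) \<ge> 0) \<and>
       (x0 \<in> frontier \<Omega> \<longrightarrow>
          max (F x0 (\<phi> x0) (D\<phi> x0) (D2\<phi> x0)) (G x0 (\<phi> x0) (D\<phi> x0)) \<ge> 0))"

definition viscosity_subsolution ::
  "(real^'n) set \<Rightarrow> (real^'n \<Rightarrow> real \<Rightarrow> real^'n \<Rightarrow> real^'n^'n \<Rightarrow> real) \<Rightarrow>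
   (real^'n \<Rightarrow> real \<Rightarrow> real^'n \<Rightarrow> real) \<Rightarrow> (real^'n \<Rightarrow> real) \<Rightarrow> bool"
  where "viscosity_subsolution \<Omega> F G u \<longleftrightarrow>
    upper_semicontinuous_on (closure \<Omega>) u \<and>
    (\<forall>x0\<in>closure \<Omega>. \<forall>\<phi> D\<phi> D2\<phi>.
       C2_closure \<Omega> \<phi> D\<phi> D2\<phi> \<and> u x0 = \<phi> x0 \<and> strict_max_at (closure \<Omega>) (\<lambda>x. u x - \<phi> x) x0 \<longrightarrow>
       (x0 \<in> \<Omega> \<longrightarrow> F x0 (\<phi> x0) (D\<phi> x0) (D2\<phi> x0) \<le> 0) \<and>
       (x0 \<in> frontier \<Omega> \<longrightarrow>
          min (F x0 (\<phi> x0) (D\<phi> x0) (D2\<phi> x0)) (G x0 (\<phi> x0) (D\<phi> x0)) \<le> 0))"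

definition viscosity_solution ::
  "(real^'n) set \<Rightarrow> (real^'n \<Rightarrow> real \<Rightarrow> real^'n \<Rightarrow> real^'n^'n \<Rightarrow> real) \<Rightarrow>
   (real^'n \<Rightarrow> real \<Rightarrow> real^'n \<Rightarrow> real) \<Rightarrow> (real^'n \<Rightarrow> real) \<Rightarrow> bool"
  where "viscosity_solution \<Omega> F G u \<longleftrightarrow>
    continuous_on (closure \<Omega>) u \<and>
    viscosity_supersolution \<Omega> F G u \<and> viscosity_subsolution \<Omega> F G u"

text \<open>
  The infinity Laplacian, as a function of the gradient \<open>\<xi>\<close> and the Hessian \<open>X\<close>.
\<close>

definition infinity_Laplacian :: "real^'n \<Rightarrow> real^'n^'n \<Rightarrow> real"
  where "infinity_Laplacian \<xi> X = (X *v \<xi>) \<bullet> \<xi>"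

definition F_eq :: "real \<Rightarrow> real^'n \<Rightarrow> real \<Rightarrow> real^'n \<Rightarrow> real^'n^'n \<Rightarrow> real"
  where "F_eq lam x r \<xi> X = - min (norm \<xi> - lam * r) (infinity_Laplacian \<xi> X)"

definition G_bc :: "real \<Rightarrow> (real^'n \<Rightarrow> real^'n) \<Rightarrow> real^'n \<Rightarrow> real \<Rightarrow> real^'n \<Rightarrow> real"
  where "G_bc \<beta> \<nu> x r \<xi> = min (norm \<xi> - \<beta> * r) (\<xi> \<bullet> \<nu> x)"

definition positive_eigenfunction ::
  "(real^'n) set \<Rightarrow> (real^'n \<Rightarrow> real^'n) \<Rightarrow> real \<Rightarrow> real \<Rightarrow> (real^'n \<Rightarrow> real) \<Rightarrow> bool"
  where "positive_eigenfunction \<Omega> \<nu> \<beta> lam u \<longleftrightarrow>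
    viscosity_solution \<Omega> (F_eq lam) (G_bc \<beta> \<nu>) u \<and> (\<forall>x\<in>\<Omega>. u x > 0)"

end

theory Submission
  imports Defs
begin

text \<open>
  The subsolution property says \<open>|\<nabla>u| \<ge> lam u\<close>, so \<open>u\<close> attains its maximum at a boundary point.
  If \<open>\<beta> < c < lam\<close>, take an interior ball with centre \<open>z\<close> and radius \<open>R\<close> at that point and maximise
  \<open>u exp (- c |x - z|\<^sup>2 / (2R))\<close>. Comparison with the maximum of \<open>u\<close> forces the new maximum point
  into the closed ball, where the gradient of the touching function has norm at most \<open>c u < lam u\<close>.
  Such a point is not in the open domain, hence it lies both on the sphere and on the boundary; there
  the gradient is a positive multiple of the outer normal of norm \<open>c u > \<beta> u\<close>, which the
  boundary condition excludes.

  If \<open>lam < c < \<beta>\<close>, then \<open>u\<close> is positive up to the boundary by Hopf's lemma, and a positive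
  multiple of \<open>exp (p \<bullet> x)\<close> with \<open>|p| = c\<close> touches \<open>u\<close> from below. At any contact point it violates the
  supersolution condition, interior or boundary, since its infinity Laplacian is positive.
\<close>

section \<open>Test functions of class C^2 with their gradients and Hessians\<close>

lemma C2_closure_add:
  assumes "C2_closure S f Df D2f" and "C2_closure S g Dg D2g"
  shows "C2_closure S (\<lambda>x. f x + g x) (\<lambda>x. Df x + Dg x) (\<lambda>x. D2f x + D2g x)"
  using assms unfolding C2_closure_def gderiv_def
  by (auto intro!: derivative_eq_intros continuous_intros ext
      simp: inner_add_right matrix_vector_mult_add_rdistrib)

lemma C2_closure_const: "C2_closure S (\<lambda>x. a) (\<lambda>x. 0) (\<lambda>x. 0)"
  unfolding C2_closure_def gderiv_def
  by (auto intro!: derivative_eq_intros ext)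

text \<open>The tensor square of \<open>v\<close>. It is the rank-one term in the Hessian of a
  scalar function composed with a function of gradient \<open>v\<close>.\<close>

definition outer_square :: "real^'n \<Rightarrow> real^'n^'n"
  where "outer_square v = (\<chi> i j. v $ i * v $ j)"

lemma outer_square_mult_vec: "outer_square v *v h = (v \<bullet> h) *\<^sub>R v"
  by (simp add: vec_eq_iff outer_square_def matrix_vector_mult_def inner_vec_def
      sum_distrib_left sum_distrib_right mult_ac)

lemma continuous_on_outer_square [continuous_intros]:
  assumes "continuous_on S f"
  shows "continuous_on S (\<lambda>x. outer_square (f x))"
  unfolding outer_square_def by (intro continuous_intros assms)

text \<open>The chain rule to second order. Exponentials, scaled squares and quartic perturbations
  are all obtained from it by a choice of \<open>f\<close>.\<close>

lemma C2_closure_compose: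
  fixes f f' f'' :: "real \<Rightarrow> real"
  assumes q: "C2_closure S q Dq D2q"
    and f: "\<And>s. (f has_real_derivative f' s) (at s)"
    and f': "\<And>s. (f' has_real_derivative f'' s) (at s)"
    and f'': "continuous_on UNIV f''"
  shows "C2_closure S (\<lambda>x. f (q x)) (\<lambda>x. f' (q x) *\<^sub>R Dq x)
    (\<lambda>x. f' (q x) *\<^sub>R D2q x + f'' (q x) *\<^sub>R outer_square (Dq x))"
proof -
  have cont: "continuous_on (closure S) (\<lambda>x. g (q x))" if "continuous_on UNIV g" for g :: "real \<Rightarrow> real"
    using q continuous_on_compose2[OF that] unfolding C2_closure_def by auto
  have cf: "continuous_on UNIV f" "continuous_on UNIV f'"
    using f f' by (meson DERIV_isCont continuous_at_imp_continuous_on)+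
  have comp: "((\<lambda>x. g (q x)) has_derivative (\<lambda>h. (h \<bullet> Dq x) * g' (q x))) (at x)"
    if "\<And>s. (g has_real_derivative g' s) (at s)" "x \<in> S" for g g' x
    using q that DERIV_compose_FDERIV[of g "g' (q x)" q x "\<lambda>h. h \<bullet> Dq x" UNIV]
    unfolding C2_closure_def gderiv_def by auto
  have d2: "((\<lambda>x. f' (q x) *\<^sub>R Dq x) has_derivative
      (\<lambda>h. (f' (q x) *\<^sub>R D2q x + f'' (q x) *\<^sub>R outer_square (Dq x)) *v h)) (at x)"
    if "x \<in> S" for x
  proof -
    have "(Dq has_derivative (\<lambda>h. D2q x *v h)) (at x)"
      using q that unfolding C2_closure_def by auto
    from has_derivative_scaleR[OF comp[OF f' that] this] show ?thesis
      by (rule has_derivative_eq_rhs)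
        (auto simp: matrix_vector_mult_add_rdistrib outer_square_mult_vec
          scaleR_matrix_vector_assoc[symmetric] inner_commute)
  qed
  show ?thesis
    using comp[OF f] d2 cont[OF cf(1)] cont[OF cf(2)] cont[OF f''] q
    unfolding C2_closure_def gderiv_def
    by (auto intro!: continuous_intros simp: mult.commute)
qed

lemma C2_closure_inner: "C2_closure S (\<lambda>x. p \<bullet> x) (\<lambda>x. p) (\<lambda>x. 0)"
  unfolding C2_closure_def gderiv_def
  by (auto intro!: derivative_eq_intros continuous_intros simp: inner_commute)

lemma C2_closure_norm_sq:
  "C2_closure S (\<lambda>x. (x - z) \<bullet> (x - z)) (\<lambda>x. 2 *\<^sub>R (x - z)) (\<lambda>x. 2 *\<^sub>R mat 1)"
  unfolding C2_closure_def gderiv_def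
  by (auto intro!: derivative_eq_intros continuous_intros ext
      simp: inner_commute inner_diff scaleR_matrix_vector_assoc[symmetric])

lemma C2_closure_exp:
  assumes "C2_closure S q Dq D2q"
  shows "C2_closure S (\<lambda>x. K * exp (q x)) (\<lambda>x. (K * exp (q x)) *\<^sub>R Dq x)
    (\<lambda>x. (K * exp (q x)) *\<^sub>R (D2q x + outer_square (Dq x)))"
proof -
  have "((\<lambda>s. K * exp s) has_real_derivative K * exp s) (at s)" for s :: real
    by (auto intro!: derivative_eq_intros)
  from C2_closure_compose[OF assms this this] show ?thesis
    by (simp add: scaleR_add_right continuous_on_mult_left continuous_on_exp)
qed

lemma C2_closure_scale_norm_sq:
  "C2_closure S (\<lambda>x. a * ((x - z) \<bullet> (x - z))) (\<lambda>x. (2 * a) *\<^sub>R (x - z)) (\<lambda>x. (2 * a) *\<^sub>R mat 1)"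
proof -
  have "C2_closure S (\<lambda>x. a * ((x - z) \<bullet> (x - z))) (\<lambda>x. a *\<^sub>R 2 *\<^sub>R (x - z))
     (\<lambda>x. a *\<^sub>R 2 *\<^sub>R mat 1 + 0 *\<^sub>R outer_square (2 *\<^sub>R (x - z)))"
    by (rule C2_closure_compose[OF C2_closure_norm_sq]) (auto intro!: derivative_eq_intros)
  then show ?thesis by (simp add: mult.commute)
qed

text \<open>A quartic perturbation makes a contact strict without changing the second order jet.\<close>

lemma C2_closure_quartic:
  obtains Q :: "real^'n \<Rightarrow> real^'n" and Q2
  where "C2_closure S (\<lambda>x. a * ((x - z) \<bullet> (x - z))\<^sup>2) Q Q2" "Q z = 0" "Q2 z = 0"
proof (rule that)
  show "C2_closure S (\<lambda>x. a * ((x - z) \<bullet> (x - z))\<^sup>2)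
     (\<lambda>x. (2 * a * ((x - z) \<bullet> (x - z))) *\<^sub>R 2 *\<^sub>R (x - z))
     (\<lambda>x. (2 * a * ((x - z) \<bullet> (x - z))) *\<^sub>R 2 *\<^sub>R mat 1 + (2 * a) *\<^sub>R outer_square (2 *\<^sub>R (x - z)))"
    by (rule C2_closure_compose[OF C2_closure_norm_sq]) (auto intro!: derivative_eq_intros)
qed (auto simp: outer_square_def vec_eq_iff)

section \<open>Viscosity inequalities at contacts that need not be strict\<close>

text \<open>Subtracting the fourth power of the distance to \<open>x0\<close> turns contact from
  below into strict contact. Its gradient and Hessian vanish at \<open>x0\<close>, so
  \<open>F\<close> and \<open>G\<close> are evaluated at the same jet.\<close>

lemma viscosity_supersolution_touching:
  assumes u: "viscosity_supersolution \<Omega> F G u" and x0: "x0 \<in> closure \<Omega>"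
    and \<phi>: "C2_closure \<Omega> \<phi> D\<phi> D2\<phi>" and eq: "\<phi> x0 = u x0"
    and le: "\<And>x. x \<in> closure \<Omega> \<Longrightarrow> \<phi> x \<le> u x"
  shows "x0 \<in> \<Omega> \<Longrightarrow> F x0 (u x0) (D\<phi> x0) (D2\<phi> x0) \<ge> 0"
    and "x0 \<in> frontier \<Omega> \<Longrightarrow>
      max (F x0 (u x0) (D\<phi> x0) (D2\<phi> x0)) (G x0 (u x0) (D\<phi> x0)) \<ge> 0"
proof -
  obtain Q Q2 where Q: "C2_closure \<Omega> (\<lambda>x. -1 * ((x - x0) \<bullet> (x - x0))\<^sup>2) Q Q2" "Q x0 = 0" "Q2 x0 = 0"
    by (rule C2_closure_quartic)
  let ?\<psi> = "\<lambda>x. \<phi> x + -1 * ((x - x0) \<bullet> (x - x0))\<^sup>2"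
  have "strict_min_at (closure \<Omega>) (\<lambda>x. u x - ?\<psi> x) x0"
    unfolding strict_min_at_def
  proof (intro conjI ballI x0)
    fix x assume x: "x \<in> closure \<Omega> - {x0}"
    have "((x - x0) \<bullet> (x - x0))\<^sup>2 > 0" using x by simp
    moreover have "u x0 - ?\<psi> x0 = 0" by (simp add: eq)
    ultimately show "u x0 - ?\<psi> x0 < u x - ?\<psi> x"
      using le[OF DiffD1[OF x]] by linarith
  qed
  then have *: "(x0 \<in> \<Omega> \<longrightarrow> F x0 (?\<psi> x0) (D\<phi> x0 + Q x0) (D2\<phi> x0 + Q2 x0) \<ge> 0) \<and>
    (x0 \<in> frontier \<Omega> \<longrightarrow> max (F x0 (?\<psi> x0) (D\<phi> x0 + Q x0) (D2\<phi> x0 + Q2 x0))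
      (G x0 (?\<psi> x0) (D\<phi> x0 + Q x0)) \<ge> 0)"
    using C2_closure_add[OF \<phi> Q(1)]
    by (intro u[unfolded viscosity_supersolution_def, THEN conjunct2, THEN bspec, OF x0,
          THEN spec[where x = "?\<psi>"], THEN spec[where x = "\<lambda>x. D\<phi> x + Q x"],
          THEN spec[where x = "\<lambda>x. D2\<phi> x + Q2 x"], THEN mp]) (simp add: eq)
  show "x0 \<in> \<Omega> \<Longrightarrow> F x0 (u x0) (D\<phi> x0) (D2\<phi> x0) \<ge> 0"
    "x0 \<in> frontier \<Omega> \<Longrightarrow> max (F x0 (u x0) (D\<phi> x0) (D2\<phi> x0)) (G x0 (u x0) (D\<phi> x0)) \<ge> 0"
    using * Q eq by auto
qed

text \<open>Mirror image for contact from above, with the quartic added.\<close>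

lemma viscosity_subsolution_touching:
  assumes u: "viscosity_subsolution \<Omega> F G u" and x0: "x0 \<in> closure \<Omega>"
    and \<phi>: "C2_closure \<Omega> \<phi> D\<phi> D2\<phi>" and eq: "\<phi> x0 = u x0"
    and le: "\<And>x. x \<in> closure \<Omega> \<Longrightarrow> u x \<le> \<phi> x"
  shows "x0 \<in> \<Omega> \<Longrightarrow> F x0 (u x0) (D\<phi> x0) (D2\<phi> x0) \<le> 0"
    and "x0 \<in> frontier \<Omega> \<Longrightarrow>
      min (F x0 (u x0) (D\<phi> x0) (D2\<phi> x0)) (G x0 (u x0) (D\<phi> x0)) \<le> 0"
proof -
  obtain Q Q2 where Q: "C2_closure \<Omega> (\<lambda>x. 1 * ((x - x0) \<bullet> (x - x0))\<^sup>2) Q Q2" "Q x0 = 0" "Q2 x0 = 0"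
    by (rule C2_closure_quartic)
  let ?\<psi> = "\<lambda>x. \<phi> x + 1 * ((x - x0) \<bullet> (x - x0))\<^sup>2"
  have "strict_max_at (closure \<Omega>) (\<lambda>x. u x - ?\<psi> x) x0"
    unfolding strict_max_at_def
  proof (intro conjI ballI x0)
    fix x assume x: "x \<in> closure \<Omega> - {x0}"
    have "((x - x0) \<bullet> (x - x0))\<^sup>2 > 0" using x by simp
    moreover have "u x0 - ?\<psi> x0 = 0" by (simp add: eq)
    ultimately show "u x - ?\<psi> x < u x0 - ?\<psi> x0"
      using le[OF DiffD1[OF x]] by linarith
  qed
  then have *: "(x0 \<in> \<Omega> \<longrightarrow> F x0 (?\<psi> x0) (D\<phi> x0 + Q x0) (D2\<phi> x0 + Q2 x0) \<le> 0) \<and>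
    (x0 \<in> frontier \<Omega> \<longrightarrow> min (F x0 (?\<psi> x0) (D\<phi> x0 + Q x0) (D2\<phi> x0 + Q2 x0))
      (G x0 (?\<psi> x0) (D\<phi> x0 + Q x0)) \<le> 0)"
    using C2_closure_add[OF \<phi> Q(1)]
    by (intro u[unfolded viscosity_subsolution_def, THEN conjunct2, THEN bspec, OF x0,
          THEN spec[where x = "?\<psi>"], THEN spec[where x = "\<lambda>x. D\<phi> x + Q x"],
          THEN spec[where x = "\<lambda>x. D2\<phi> x + Q2 x"], THEN mp]) (simp add: eq)
  show "x0 \<in> \<Omega> \<Longrightarrow> F x0 (u x0) (D\<phi> x0) (D2\<phi> x0) \<le> 0"
    "x0 \<in> frontier \<Omega> \<Longrightarrow> min (F x0 (u x0) (D\<phi> x0) (D2\<phi> x0)) (G x0 (u x0) (D\<phi> x0)) \<le> 0"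
    using * Q eq by auto
qed

section \<open>Normals and interior balls of a C^2 boundary\<close>

text \<open>Removing from \<open>v\<close> its projection onto \<open>N\<close> leaves a vector
  orthogonal to \<open>N\<close>, hence to \<open>v\<close>, hence to itself.\<close>

lemma parallel_if_orthogonal_complement:
  fixes v N :: "'a::real_inner"
  assumes "N \<noteq> 0" and "\<And>w. N \<bullet> w = 0 \<Longrightarrow> v \<bullet> w = 0"
  obtains a where "v = a *\<^sub>R N"
proof -
  define a where "a = (v \<bullet> N) / (N \<bullet> N)"
  have "N \<bullet> (v - a *\<^sub>R N) = 0"
    using assms(1) by (simp add: a_def inner_diff_right inner_commute)
  moreover from assms(2)[OF this] have "v \<bullet> (v - a *\<^sub>R N) = 0" .
  ultimately have "(v - a *\<^sub>R N) \<bullet> (v - a *\<^sub>R N) = 0"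
    by (simp add: inner_diff_left)
  then have "v = a *\<^sub>R N" by simp
  then show ?thesis by (rule that)
qed

lemma C2_closure_UNIV_iff:
  "C2_closure UNIV \<phi> D\<phi> D2\<phi> \<longleftrightarrow> (\<forall>x. GDERIV \<phi> x :> D\<phi> x) \<and>
     (\<forall>x. (D\<phi> has_derivative (\<lambda>h. D2\<phi> x *v h)) (at x)) \<and> continuous_on UNIV D2\<phi>"
  unfolding C2_closure_def gderiv_def
  by (auto intro: has_derivative_continuous continuous_at_imp_continuous_on)

text \<open>The mean value inequality is used twice: a Hessian bound on the compact ball controls
  \<open>D\<gamma> x - D\<gamma> x0\<close> linearly, which in turn controls \<open>\<gamma>\<close>
  minus its linear part quadratically. The factor 1/2 of Taylor's formula is given up.\<close>

lemma C2_taylor_bound: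
  fixes \<gamma> :: "real^'n \<Rightarrow> real"
  assumes "C2_closure UNIV \<gamma> D\<gamma> D2\<gamma>"
  obtains C where "C > 0"
    "\<And>x. x \<in> cball x0 r \<Longrightarrow> \<gamma> x \<le> \<gamma> x0 + D\<gamma> x0 \<bullet> (x - x0) + C * (norm (x - x0))\<^sup>2"
proof -
  have d1: "(\<gamma> has_derivative (\<lambda>h. h \<bullet> D\<gamma> x)) (at x)"
    and d2: "(D\<gamma> has_derivative (\<lambda>h. D2\<gamma> x *v h)) (at x)" for x
    using assms unfolding C2_closure_UNIV_iff gderiv_def by auto
  have "compact (D2\<gamma> ` cball x0 r)"
    using assms unfolding C2_closure_UNIV_iff
    by (auto intro!: compact_continuous_image intro: continuous_on_subset)
  then obtain M where "M > 0" and M: "\<And>x. x \<in> cball x0 r \<Longrightarrow> norm (D2\<gamma> x) \<le> M"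
    by (auto dest!: compact_imp_bounded simp: bounded_pos)
  \<comment> \<open>A crude bound for the operator norm of a matrix whose entries are at most
    \<open>M\<close>.\<close>
  define C where "C = real CARD('n) * real CARD('n) * M"
  have "C > 0" using \<open>M > 0\<close> by (simp add: C_def)
  have on: "onorm ((*v) (D2\<gamma> x)) \<le> C" if "x \<in> cball x0 r" for x
    unfolding C_def
  proof (rule onorm_le_matrix_component)
    fix i j
    have "norm (D2\<gamma> x $ i $ j) \<le> norm (D2\<gamma> x)"
      using Finite_Cartesian_Product.norm_nth_le[of "D2\<gamma> x $ i" j]
        Finite_Cartesian_Product.norm_nth_le[of "D2\<gamma> x" i] by (rule order_trans)
    then show "\<bar>D2\<gamma> x $ i $ j\<bar> \<le> M" using M[OF that] by simp
  qed
  have lip: "norm (D\<gamma> x - D\<gamma> x0) \<le> C * norm (x - x0)" if "x \<in> cball x0 r" for x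
  proof (rule differentiable_bound[of "cball x0 r"])
    show "x0 \<in> cball x0 r" using that by (auto intro: order_trans[OF zero_le_dist])
  qed (use that on d2 in \<open>auto intro: has_derivative_at_withinI\<close>)
  have "\<gamma> x \<le> \<gamma> x0 + D\<gamma> x0 \<bullet> (x - x0) + C * (norm (x - x0))\<^sup>2" if "x \<in> cball x0 r" for x
  proof -
    let ?s = "norm (x - x0)"
    let ?g = "\<lambda>y. \<gamma> y - D\<gamma> x0 \<bullet> y"
    have "norm (?g x - ?g x0) \<le> (C * ?s) * norm (x - x0)"
    proof (rule differentiable_bound[of "cball x0 ?s"])
      fix y assume y: "y \<in> cball x0 ?s"
      show "(?g has_derivative (\<lambda>h. h \<bullet> (D\<gamma> y - D\<gamma> x0))) (at y within cball x0 ?s)"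
        by (auto intro!: derivative_eq_intros d1[THEN has_derivative_at_withinI]
            simp: inner_diff_right inner_commute)
      have "norm (D\<gamma> y - D\<gamma> x0) \<le> C * norm (y - x0)"
        using y that by (intro lip) (auto simp: dist_norm norm_minus_commute)
      also have "\<dots> \<le> C * ?s"
        using y \<open>C > 0\<close> by (intro mult_left_mono) (auto simp: dist_norm norm_minus_commute)
      finally have "norm (D\<gamma> y - D\<gamma> x0) \<le> C * ?s" .
      then have "norm h * norm (D\<gamma> y - D\<gamma> x0) \<le> C * ?s * norm h" for h :: "real^'n"
        by (subst mult.commute) (rule mult_right_mono, auto)
      then show "onorm (\<lambda>h. h \<bullet> (D\<gamma> y - D\<gamma> x0)) \<le> C * ?s"
        by (intro onorm_le) (metis Cauchy_Schwarz_ineq2 order_trans real_norm_def)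
    qed (auto simp: dist_norm norm_minus_commute)
    then show ?thesis by (simp add: inner_diff_right power2_eq_square abs_le_iff)
  qed
  with \<open>C > 0\<close> show ?thesis by (rule that)
qed

text \<open>\<open>N\<close> is the (non-normalised) outer normal \<open>\<nabla>\<gamma> - e\<close> of the local graph.\<close>

lemma C2_boundary_chart:
  assumes "open \<Omega>" and "C2_boundary \<Omega>" and x0: "x0 \<in> frontier \<Omega>"
  obtains r C N where "r > 0" "C > 0" "N \<noteq> 0"
    "\<And>x. x \<in> ball x0 r \<Longrightarrow> N \<bullet> (x - x0) + C * (norm (x - x0))\<^sup>2 < 0 \<Longrightarrow> x \<in> \<Omega>"
    "\<And>w. N \<bullet> w = 0 \<Longrightarrow> tangent_vector (frontier \<Omega>) x0 w"
proof -
  obtain r e \<gamma> D\<gamma> D2\<gamma> where r: "r > 0" and e: "norm e = 1" and C2: "C2_closure UNIV \<gamma> D\<gamma> D2\<gamma>"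
    and inv: "\<And>x t. \<gamma> (x + t *\<^sub>R e) = \<gamma> x"
    and graph: "\<And>x. x \<in> ball x0 r \<Longrightarrow> x \<in> \<Omega> \<longleftrightarrow> \<gamma> x < x \<bullet> e"
    using assms unfolding C2_boundary_def by metis
  have d1: "(\<gamma> has_derivative (\<lambda>h. h \<bullet> D\<gamma> x)) (at x)" for x
    using C2 unfolding C2_closure_UNIV_iff gderiv_def by auto
  have ee: "e \<bullet> e = 1" using e by (simp add: norm_eq_1)
  have cont: "isCont (\<lambda>x. \<gamma> x - x \<bullet> e) x" for x
    by (intro continuous_intros has_derivative_continuous[OF d1])
  have ball: "\<forall>\<^sub>F x in nhds y. x \<in> ball x0 r" if "y \<in> ball x0 r" for y
    using that by (intro eventually_nhds_in_open) auto
  \<comment> \<open>Within the chart the frontier is the graph. A point strictly below the graph has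
    a neighbourhood disjoint from \<open>\<Omega>\<close>; a point on it is a limit of points of
    \<open>\<Omega>\<close> obtained by moving up along \<open>e\<close>.\<close>
  have fr: "y \<in> frontier \<Omega> \<longleftrightarrow> \<gamma> y = y \<bullet> e" if y: "y \<in> ball x0 r" for y
  proof
    assume "y \<in> frontier \<Omega>"
    then have cl: "y \<in> closure \<Omega>" and "y \<notin> \<Omega>"
      using \<open>open \<Omega>\<close> by (auto simp: frontier_def interior_open)
    then have "\<gamma> y \<ge> y \<bullet> e" using graph[OF y] by auto
    moreover have "\<not> \<gamma> y > y \<bullet> e"
    proof
      assume "\<gamma> y > y \<bullet> e"
      then have "\<forall>\<^sub>F x in nhds y. \<gamma> x - x \<bullet> e > 0"
        using cont[of y, unfolded isCont_def, THEN order_tendstoD(1), of 0]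
        by (auto simp: eventually_nhds_conv_at)
      with ball[OF y] have "\<forall>\<^sub>F x in nhds y. x \<notin> \<Omega>"
        by eventually_elim (use graph in auto)
      then show False
        using cl unfolding closure_iff_nhds_not_empty eventually_nhds
        by (metis Int_emptyI disjoint_iff order_refl)
    qed
    ultimately show "\<gamma> y = y \<bullet> e" by simp
  next
    assume eq: "\<gamma> y = y \<bullet> e"
    have "((\<lambda>t. y + t *\<^sub>R e) \<longlongrightarrow> y + 0 *\<^sub>R e) (at_right 0)" by (intro tendsto_intros)
    then have lim: "((\<lambda>t. y + t *\<^sub>R e) \<longlongrightarrow> y) (at_right 0)" by simp
    have "\<forall>\<^sub>F t in at_right 0. y + t *\<^sub>R e \<in> ball x0 r"
      using topological_tendstoD[OF lim, of "ball x0 r"] y by auto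
    moreover have "\<forall>\<^sub>F t::real in at_right 0. t > 0" by (simp add: eventually_at_right_less)
    ultimately have "\<forall>\<^sub>F t in at_right 0. y + t *\<^sub>R e \<in> \<Omega>"
      by eventually_elim (simp add: graph inv eq inner_add_left ee)
    then have "\<forall>\<^sub>F t in at_right 0. y + t *\<^sub>R e \<in> closure \<Omega>"
      by eventually_elim (use closure_subset in auto)
    then have "y \<in> closure \<Omega>"
      using Lim_in_closed_set[OF closed_closure _ _ lim] by simp
    moreover have "y \<notin> \<Omega>" using graph[OF y] eq by simp
    ultimately show "y \<in> frontier \<Omega>" using \<open>open \<Omega>\<close> by (simp add: frontier_def interior_open)
  qed
  have x0eq: "\<gamma> x0 = x0 \<bullet> e" using fr x0 r by simp
  define N where "N = D\<gamma> x0 - e"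
  \<comment> \<open>Differentiating the invariance of \<open>\<gamma>\<close> along \<open>e\<close>
    shows \<open>D\<gamma> x0\<close> orthogonal to \<open>e\<close>, so \<open>N\<close> has
    component -1 along \<open>e\<close> and cannot vanish.\<close>
  have "((\<lambda>t. \<gamma> (x0 + t *\<^sub>R e)) has_derivative (\<lambda>t. (t *\<^sub>R e) \<bullet> D\<gamma> x0)) (at 0)"
    by (rule has_derivative_compose[of "\<lambda>t. x0 + t *\<^sub>R e" "\<lambda>t. t *\<^sub>R e" 0 UNIV \<gamma>])
      (auto intro!: derivative_eq_intros d1)
  moreover have "((\<lambda>t. \<gamma> (x0 + t *\<^sub>R e)) has_derivative (\<lambda>t. 0)) (at (0::real))"
    unfolding inv by simp
  ultimately have "(\<lambda>t. (t *\<^sub>R e) \<bullet> D\<gamma> x0) = (\<lambda>t::real. 0)" by (rule has_derivative_unique)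
  from fun_cong[OF this, of 1] have eD: "e \<bullet> D\<gamma> x0 = 0" by simp
  then have "N \<bullet> e = -1" by (simp add: N_def inner_diff_left ee) (simp add: inner_commute)
  then have "N \<noteq> 0" by auto
  obtain C where "C > 0" and
    C: "\<And>x. x \<in> cball x0 r \<Longrightarrow> \<gamma> x \<le> \<gamma> x0 + D\<gamma> x0 \<bullet> (x - x0) + C * (norm (x - x0))\<^sup>2"
    using C2_taylor_bound[OF C2] by metis
  show ?thesis
  proof (rule that[OF r \<open>C > 0\<close> \<open>N \<noteq> 0\<close>])
    fix x assume "x \<in> ball x0 r" and "N \<bullet> (x - x0) + C * (norm (x - x0))\<^sup>2 < 0"
    then show "x \<in> \<Omega>"
      using C[of x] graph[of x] x0eq by (auto simp: N_def inner_diff_left inner_diff_right inner_commute)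
  next
    fix w assume w: "N \<bullet> w = 0"
    \<comment> \<open>The straight line through \<open>x0\<close> in direction \<open>w\<close>,
      moved along \<open>e\<close> onto the graph. The correction has derivative
      \<open>(N \<bullet> w) *\<^sub>R e = 0\<close> at 0, so the velocity remains
      \<open>w\<close>.\<close>
    define c where "c t = x0 + t *\<^sub>R w + (\<gamma> (x0 + t *\<^sub>R w) - (x0 + t *\<^sub>R w) \<bullet> e) *\<^sub>R e" for t :: real
    have g: "((\<lambda>t. \<gamma> (x0 + t *\<^sub>R w)) has_derivative (\<lambda>t. (t *\<^sub>R w) \<bullet> D\<gamma> x0)) (at 0)"
      by (rule has_derivative_compose[of "\<lambda>t. x0 + t *\<^sub>R w" "\<lambda>t. t *\<^sub>R w" 0 UNIV \<gamma>])
        (auto intro!: derivative_eq_intros d1)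
    have "w \<bullet> D\<gamma> x0 - w \<bullet> e = 0" using w by (simp add: N_def inner_diff_left) (simp add: inner_commute)
    then have der: "(c has_vector_derivative w) (at 0)"
      unfolding c_def has_vector_derivative_def
      by (auto intro!: derivative_eq_intros g ext simp: right_diff_distrib[symmetric])
    have c0: "c 0 = x0" by (simp add: c_def x0eq)
    have "\<forall>\<^sub>F t in nhds 0. c t \<in> ball x0 r"
      using has_vector_derivative_continuous[OF der] c0 r
      by (auto simp: continuous_at eventually_nhds_conv_at dest: topological_tendstoD[of _ _ _ "ball x0 r"])
    then have "\<forall>\<^sub>F t in nhds 0. c t \<in> frontier \<Omega>"
      by eventually_elim (simp add: fr c_def inv inner_add_left ee)
    then show "tangent_vector (frontier \<Omega>) x0 w"
      unfolding tangent_vector_def using der c0 by blast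
  qed
qed

text \<open>The inequality supplied by the chart itself describes a ball with \<open>x0\<close> on
  its boundary. A smaller ball, internally tangent to it at \<open>x0\<close>, also stays within the
  chart.\<close>

lemma interior_ball:
  assumes "open \<Omega>" and "C2_boundary \<Omega>" and "x0 \<in> frontier \<Omega>"
  obtains z R where "R > 0" "norm (x0 - z) = R" "ball z R \<subseteq> \<Omega>"
proof -
  obtain r C N where r: "r > 0" and C: "C > 0" and N: "N \<noteq> 0"
    and chart: "\<And>x. x \<in> ball x0 r \<Longrightarrow> N \<bullet> (x - x0) + C * (norm (x - x0))\<^sup>2 < 0 \<Longrightarrow> x \<in> \<Omega>"
    using C2_boundary_chart[OF assms] by metis
  \<comment> \<open>The first bound keeps the diameter of the ball at most \<open>r\<close>; the
    second gives \<open>2 * s * C \<le> 1\<close>, which places the ball inside the region described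
    by the chart.\<close>
  define s where "s = min (r / (2 * norm N)) (1 / (2 * C))"
  define z where "z = x0 - s *\<^sub>R N"
  have s: "s > 0" "s * norm N \<le> r / 2" "C * s \<le> 1 / 2"
    using r C N by (auto simp: s_def min_def field_simps split: if_splits)
  show ?thesis
  proof (rule that)
    show "s * norm N > 0" using s N by simp
    show "norm (x0 - z) = s * norm N" using s by (simp add: z_def)
    show "ball z (s * norm N) \<subseteq> \<Omega>"
    proof
      fix x assume "x \<in> ball z (s * norm N)"
      then have lt: "norm (x - z) < s * norm N" by (simp add: dist_norm norm_minus_commute)
      have "norm (x - x0) \<le> norm (x - z) + norm (z - x0)"
        using norm_triangle_ineq[of "x - z" "z - x0"] by simp
      also have "\<dots> < r" using lt s by (simp add: z_def)
      finally have "x \<in> ball x0 r" by (simp add: dist_norm norm_minus_commute)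
      moreover have "N \<bullet> (x - x0) + C * (norm (x - x0))\<^sup>2 < 0"
      proof -
        have "(norm (x - z))\<^sup>2 < (s * norm N)\<^sup>2"
          using lt by (intro power_strict_mono) auto
        moreover have "x - z = (x - x0) + s *\<^sub>R N" by (simp add: z_def)
        ultimately have *: "(norm (x - x0))\<^sup>2 + 2 * s * (N \<bullet> (x - x0)) < 0"
          unfolding power_mult_distrib power2_norm_eq_inner
          by (simp add: inner_add_left inner_add_right inner_commute power2_eq_square)
        have "2 * s * C * (norm (x - x0))\<^sup>2 \<le> 1 * (norm (x - x0))\<^sup>2"
          using s by (intro mult_right_mono) (auto simp: mult_ac)
        then have "2 * s * (N \<bullet> (x - x0) + C * (norm (x - x0))\<^sup>2) < 0"
          using * by (simp add: algebra_simps)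
        then show ?thesis using s(1) by (simp add: mult_less_0_iff)
      qed
      ultimately show "x \<in> \<Omega>" by (rule chart)
    qed
  qed
qed

text \<open>Curves in the frontier avoid the ball, so their distance to \<open>z\<close> is least at
  \<open>x0\<close>; hence \<open>x0 - z\<close> is orthogonal to all tangent vectors and parallel
  to \<open>v\<close>. The sign follows because otherwise small steps from \<open>x0\<close> along
  \<open>v\<close> would enter the ball.\<close>

lemma outer_normal_interior_ball:
  assumes "open \<Omega>" and "C2_boundary \<Omega>" and x0: "x0 \<in> frontier \<Omega>"
    and v: "outer_unit_normal \<Omega> x0 v"
    and R: "R > 0" "norm (x0 - z) = R" and ball: "ball z R \<subseteq> \<Omega>"
  shows "(x0 - z) \<bullet> v > 0"
proof -
  define y where "y = x0 - z"
  obtain N where N: "N \<noteq> 0" "\<And>w. N \<bullet> w = 0 \<Longrightarrow> tangent_vector (frontier \<Omega>) x0 w"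
    using C2_boundary_chart[OF assms(1-3)] by metis
  have "y \<bullet> w = 0" if w: "tangent_vector (frontier \<Omega>) x0 w" for w
  proof -
    obtain c where c: "c 0 = x0" "\<forall>\<^sub>F t in nhds 0. c t \<in> frontier \<Omega>"
      "(c has_vector_derivative w) (at 0)"
      using w unfolding tangent_vector_def by blast
    have min: "\<forall>\<^sub>F t in nhds 0. (c 0 - z) \<bullet> (c 0 - z) \<le> (c t - z) \<bullet> (c t - z)"
      using c(2)
    proof eventually_elim
      case (elim t)
      then have "c t \<notin> ball z R"
        using ball \<open>open \<Omega>\<close> by (auto simp: frontier_def interior_open)
      then show ?case
        using R by (simp add: c(1) dist_norm norm_minus_commute norm_le flip: power2_norm_eq_inner)
    qed
    have "((\<lambda>t. (c t - z) \<bullet> (c t - z)) has_real_derivative 2 * (y \<bullet> w)) (at 0)"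
      using c(3) unfolding has_vector_derivative_def has_field_derivative_def
      by (auto intro!: derivative_eq_intros ext simp: c(1) y_def inner_commute)
    then show ?thesis
      using min unfolding eventually_nhds_metric
      by (auto simp: dist_real_def dest!: DERIV_local_min)
  qed
  then obtain b where b: "y = b *\<^sub>R N" using N parallel_if_orthogonal_complement by metis
  have "v \<bullet> w = 0" if "N \<bullet> w = 0" for w
    using v N(2)[OF that] unfolding outer_unit_normal_def by blast
  then obtain a where a: "v = a *\<^sub>R N" using N(1) parallel_if_orthogonal_complement by metis
  have "norm v = 1" using v unfolding outer_unit_normal_def by blast
  \<comment> \<open>Two nonzero multiples of \<open>N\<close> are never orthogonal.\<close>
  then have "y \<bullet> v \<noteq> 0" using R a b N(1) by (auto simp: y_def)
  moreover have "\<not> y \<bullet> v < 0"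
  proof
    assume neg: "y \<bullet> v < 0"
    have "\<forall>\<^sub>F t::real in at_right 0. t < - 2 * (y \<bullet> v)"
      using neg by (intro eventually_at_right_less[THEN eventually_mono] order_tendstoD(2)[of "\<lambda>t. t" 0]) auto
    moreover have "\<forall>\<^sub>F t::real in at_right 0. t > 0" by (simp add: eventually_at_right_less)
    moreover have "\<forall>\<^sub>F t in at_right 0. x0 + t *\<^sub>R v \<notin> closure \<Omega>"
      using v unfolding outer_unit_normal_def by blast
    ultimately have "\<forall>\<^sub>F t::real in at_right 0. False"
    proof eventually_elim
      case (elim t)
      have "(norm (y + t *\<^sub>R v))\<^sup>2 = R\<^sup>2 + t * (2 * (y \<bullet> v) + t)"
      proof -
        have "y \<bullet> y = R\<^sup>2" "v \<bullet> v = 1"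
          using R(2) \<open>norm v = 1\<close> by (simp_all add: y_def flip: power2_norm_eq_inner)
        then show ?thesis
          unfolding power2_norm_eq_inner
          by (simp add: inner_add_left inner_add_right inner_commute[of v y] algebra_simps)
      qed
      also have "\<dots> < R\<^sup>2" using elim by (simp add: mult_pos_neg)
      finally have "norm (y + t *\<^sub>R v) < R" using R(1) by (simp add: power_less_imp_less_base)
      then have "x0 + t *\<^sub>R v \<in> ball z R"
        by (simp add: y_def dist_norm norm_minus_commute algebra_simps)
      then show False using elim ball closure_subset by blast
    qed
    then show False by simp
  qed
  ultimately show ?thesis by (simp add: y_def)
qed

section \<open>Exponential barriers and the two inequalities between \<open>lam\<close> and
  \<open>\<beta>\<close>\<close>

text \<open>The arguments are the gradient and Hessian of a multiple of
  \<open>exp (b |x - z|^2 / 2)\<close> at a point where its value is \<open>K\<close> and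
  \<open>y = x - z\<close>.\<close>

lemma infinity_Laplacian_radial:
  "infinity_Laplacian (K *\<^sub>R b *\<^sub>R y) (K *\<^sub>R (b *\<^sub>R mat 1 + outer_square (b *\<^sub>R y)))
     = K ^ 3 * b\<^sup>2 * (y \<bullet> y) * (b + b\<^sup>2 * (y \<bullet> y))"
  unfolding infinity_Laplacian_def
  by (simp add: scaleR_matrix_vector_assoc[symmetric] matrix_vector_mult_add_rdistrib
      outer_square_mult_vec inner_add_left power2_eq_square power3_eq_cube algebra_simps)

text \<open>The same for a multiple of \<open>exp (p \<bullet> x)\<close> with value
  \<open>K\<close>. The exponential makes the result positive for \<open>K > 0\<close> and
  \<open>p \<noteq> 0\<close>, whereas a linear function would give zero.\<close>

lemma infinity_Laplacian_linear:
  "infinity_Laplacian (K *\<^sub>R p) (K *\<^sub>R (0 + outer_square p)) = K ^ 3 * (p \<bullet> p)\<^sup>2"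
  unfolding infinity_Laplacian_def
  by (simp add: scaleR_matrix_vector_assoc[symmetric] outer_square_mult_vec
      power2_eq_square power3_eq_cube algebra_simps)

lemma subsolution_le:
  assumes "open \<Omega>" and "\<Omega> \<noteq> {}" and "bounded \<Omega>" and "C2_boundary \<Omega>"
    and normal: "\<forall>x\<in>frontier \<Omega>. outer_unit_normal \<Omega> x (\<nu> x)"
    and "\<beta> > 0"
    and cont: "continuous_on (closure \<Omega>) u"
    and sub: "viscosity_subsolution \<Omega> (F_eq lam) (G_bc \<beta> \<nu>) u"
    and pos: "\<forall>x\<in>\<Omega>. u x > 0"
  shows "lam \<le> \<beta>"
proof (rule ccontr)
  assume "\<not> lam \<le> \<beta>"
  then obtain c where c: "\<beta> < c" "c < lam" using dense[of \<beta> lam] by auto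
  have K: "compact (closure \<Omega>)" "closure \<Omega> \<noteq> {}"
    using \<open>bounded \<Omega>\<close> \<open>\<Omega> \<noteq> {}\<close> by auto
  have fr: "frontier \<Omega> = closure \<Omega> - \<Omega>"
    using \<open>open \<Omega>\<close> by (simp add: frontier_def interior_open)
  obtain x1 where x1: "x1 \<in> closure \<Omega>" and max: "\<And>x. x \<in> closure \<Omega> \<Longrightarrow> u x \<le> u x1"
    using continuous_attains_sup[OF K cont] by blast
  have M: "u x1 > 0"
    using \<open>\<Omega> \<noteq> {}\<close> pos max closure_subset by (meson all_not_in_conv less_le_trans subsetD)
  have "x1 \<notin> \<Omega>"
  proof
    assume "x1 \<in> \<Omega>"
    \<comment> \<open>At an interior maximum a constant touches from above, and there
      \<open>F_eq\<close> equals \<open>lam * u x1 > 0\<close>.\<close>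
    from viscosity_subsolution_touching(1)[OF sub x1 C2_closure_const[of \<Omega> "u x1"] refl max this]
    have "min (- (lam * u x1)) 0 \<ge> 0" by (simp add: F_eq_def infinity_Laplacian_def)
    then show False using M c \<open>\<beta> > 0\<close> by (simp add: zero_le_mult_iff mult_le_0_iff)
  qed
  then have "x1 \<in> frontier \<Omega>" using x1 fr by simp
  then obtain z R where R: "R > 0" "norm (x1 - z) = R" and ball: "ball z R \<subseteq> \<Omega>"
    by (rule interior_ball[OF assms(1,4)])
  \<comment> \<open>Chosen so that the gradient of the exponent \<open>h\<close> has norm exactly
    \<open>c\<close> on the sphere of radius \<open>R\<close>.\<close>
  define a where "a = c / (2 * R)"
  have a: "a > 0" "2 * a * R = c" using R c \<open>\<beta> > 0\<close> by (auto simp: a_def)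
  define h where "h x = a * ((x - z) \<bullet> (x - z))" for x
  have "continuous_on (closure \<Omega>) (\<lambda>x. u x * exp (- h x))"
    unfolding h_def by (intro continuous_intros cont)
  then obtain x0 where x0: "x0 \<in> closure \<Omega>"
    and max0: "\<And>x. x \<in> closure \<Omega> \<Longrightarrow> u x * exp (- h x) \<le> u x0 * exp (- h x0)"
    using continuous_attains_sup[OF K] by blast
  have "0 < u x1 * exp (- h x1)" using M by simp
  also have "\<dots> \<le> u x0 * exp (- h x0)" using max0 x1 by blast
  finally have u0: "u x0 > 0" by (simp add: zero_less_mult_iff)
  \<comment> \<open>Since \<open>u\<close> is largest at \<open>x1\<close>, the weighted maximum can
    only be at \<open>x0\<close> if the weight there is at least as large, that is, if
    \<open>x0\<close> is no farther from \<open>z\<close> than \<open>x1\<close>.\<close>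
  have "u x1 * exp (- h x1) \<le> u x0 * exp (- h x0)" using max0 x1 by blast
  also have "\<dots> \<le> u x1 * exp (- h x0)" using max x0 by (intro mult_right_mono) auto
  finally have "h x0 \<le> h x1" using M by simp
  then have le: "norm (x0 - z) \<le> R"
    using a R by (simp add: h_def flip: norm_le)
  let ?\<phi> = "\<lambda>x. (u x0 * exp (- h x0)) * exp (h x)"
  let ?D = "\<lambda>x. ?\<phi> x *\<^sub>R (2 * a) *\<^sub>R (x - z)"
  have C2: "C2_closure \<Omega> ?\<phi> ?D (\<lambda>x. ?\<phi> x *\<^sub>R ((2 * a) *\<^sub>R mat 1 + outer_square ((2 * a) *\<^sub>R (x - z))))"
    unfolding h_def by (rule C2_closure_exp[OF C2_closure_scale_norm_sq])
  have \<phi>0: "?\<phi> x0 = u x0" by (simp add: exp_minus)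
  have above: "u x \<le> ?\<phi> x" if "x \<in> closure \<Omega>" for x
    using max0[OF that] by (simp add: exp_minus field_simps)
  have D0: "?D x0 = (u x0 * (2 * a)) *\<^sub>R (x0 - z)" by (simp add: exp_minus)
  have nD: "norm (?D x0) = u x0 * (2 * a) * norm (x0 - z)"
    unfolding D0 using u0 a by simp
  also have "\<dots> \<le> u x0 * (2 * a) * R" using le u0 a by (intro mult_left_mono) auto
  also have "\<dots> = u x0 * c" using a by simp
  also have "\<dots> < lam * u x0" using c u0 by simp
  finally have lt: "norm (?D x0) < lam * u x0" .
  \<comment> \<open>The small gradient alone makes \<open>F_eq\<close> positive, whatever the
    Hessian.\<close>
  have F: "F_eq lam x0 (u x0) (?D x0) X > 0" for X
    using lt unfolding F_eq_def by linarith
  show False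
  proof (cases "x0 \<in> \<Omega>")
    case True
    from viscosity_subsolution_touching(1)[OF sub x0 C2 \<phi>0 above True] F show False
      by (meson not_le)
  next
    case False
    then have x0fr: "x0 \<in> frontier \<Omega>" using x0 fr by simp
    \<comment> \<open>Although \<open>x0\<close> may differ from \<open>x1\<close>, the same ball
      touches the frontier at \<open>x0\<close>, so the sign of the normal component is available
      there.\<close>
    have "x0 \<notin> ball z R" using False ball by blast
    then have R0: "norm (x0 - z) = R" using le by (simp add: dist_norm norm_minus_commute)
    have "norm (?D x0) = u x0 * c" unfolding nD R0 using a by simp
    moreover have "(x0 - z) \<bullet> \<nu> x0 > 0"
      using outer_normal_interior_ball[OF assms(1,4) x0fr _ R(1) R0 ball] normal x0fr by blast
    then have "?D x0 \<bullet> \<nu> x0 > 0" unfolding D0 using u0 a by simp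
    ultimately have "G_bc \<beta> \<nu> x0 (u x0) (?D x0) > 0"
      using c u0 by (simp add: G_bc_def)
    moreover have "min (F_eq lam x0 (u x0) (?D x0)
        (?\<phi> x0 *\<^sub>R ((2 * a) *\<^sub>R mat 1 + outer_square ((2 * a) *\<^sub>R (x0 - z)))))
        (G_bc \<beta> \<nu> x0 (u x0) (?D x0)) \<le> 0"
      by (rule viscosity_subsolution_touching(2)[OF sub x0 C2 \<phi>0 above x0fr])
    ultimately show False using F by (metis min_less_iff_conj not_le)
  qed
qed

text \<open>Hopf's lemma: the radial barrier \<open>exp (-\<alpha> |x - z|\<^sup>2) - exp (-\<alpha> R\<^sup>2)\<close> is a strict subsolution
  in the annulus \<open>R/2 < |x - z| \<le> R\<close>.\<close>

lemma supersolution_pos_on_closure: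
  assumes "open \<Omega>" and "bounded \<Omega>" and "C2_boundary \<Omega>"
    and normal: "\<forall>x\<in>frontier \<Omega>. outer_unit_normal \<Omega> x (\<nu> x)"
    and "lam > 0"
    and cont: "continuous_on (closure \<Omega>) u"
    and super: "viscosity_supersolution \<Omega> (F_eq lam) (G_bc \<beta> \<nu>) u"
    and pos: "\<forall>x\<in>\<Omega>. u x > 0"
    and x0: "x0 \<in> closure \<Omega>"
  shows "u x0 > 0"
proof (rule ccontr)
  assume "\<not> u x0 > 0"
  have nonneg: "u x \<ge> 0" if "x \<in> closure \<Omega>" for x
    using continuous_ge_on_closure[OF cont that, of 0] pos by (simp add: less_imp_le)
  with \<open>\<not> u x0 > 0\<close> x0 have u0: "u x0 = 0" by fastforce
  have x0fr: "x0 \<in> frontier \<Omega>"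
    using x0 u0 pos \<open>open \<Omega>\<close> by (auto simp: frontier_def interior_open)
  then obtain z R where R: "R > 0" "norm (x0 - z) = R" and ball: "ball z R \<subseteq> \<Omega>"
    by (rule interior_ball[OF assms(1,3)])
  \<comment> \<open>For \<open>|x - z| > R/2\<close>, the summand \<open>3 / R\<^sup>2\<close> makes
    the infinity Laplacian of the barrier positive, and \<open>lam / R\<close> gives
    \<open>2 * \<alpha> * |x - z| \<ge> lam\<close>, the gradient bound.\<close>
  define \<alpha> where "\<alpha> = 3 / R\<^sup>2 + lam / R"
  have \<alpha>: "\<alpha> > 0" "lam \<le> \<alpha> * R" "3 \<le> \<alpha> * R\<^sup>2"
    using R \<open>lam > 0\<close> by (auto simp: \<alpha>_def field_simps power2_eq_square add_pos_pos)
  have "cball z (R / 2) \<subseteq> \<Omega>"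
    using ball R by (auto simp: subset_iff)
  then have inner: "cball z (R / 2) \<subseteq> \<Omega>" "cball z (R / 2) \<subseteq> closure \<Omega>"
    using closure_subset by blast+
  then have "continuous_on (cball z (R / 2)) u" using cont continuous_on_subset by blast
  then obtain x2 where x2: "x2 \<in> cball z (R / 2)" and min2: "\<And>x. x \<in> cball z (R / 2) \<Longrightarrow> u x2 \<le> u x"
    using continuous_attains_inf[of "cball z (R / 2)" u] R by auto
  \<comment> \<open>With this factor the barrier stays strictly below \<open>u\<close> on the inner
    ball.\<close>
  define \<kappa> where "\<kappa> = u x2"
  have \<kappa>: "\<kappa> > 0" using x2 inner pos by (auto simp: \<kappa>_def)
  define h where "h x = - \<alpha> * ((x - z) \<bullet> (x - z))" for x
  \<comment> \<open>The subtracted constant makes \<open>w\<close> vanish on the sphere of radius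
    \<open>R\<close>, so that \<open>w > 0\<close> holds only in the open ball.\<close>
  define w where "w x = \<kappa> * exp (h x) - \<kappa> * exp (- \<alpha> * R\<^sup>2)" for x
  have h: "h x = - \<alpha> * (norm (x - z))\<^sup>2" for x by (simp add: h_def power2_norm_eq_inner)
  let ?D = "\<lambda>x. (\<kappa> * exp (h x)) *\<^sub>R (2 * - \<alpha>) *\<^sub>R (x - z)"
  let ?D2 = "\<lambda>x. (\<kappa> * exp (h x)) *\<^sub>R ((2 * - \<alpha>) *\<^sub>R mat 1 + outer_square ((2 * - \<alpha>) *\<^sub>R (x - z)))"
  \<comment> \<open>The shift \<open>s\<close> allows the barrier to be slid until it touches
    \<open>u\<close>.\<close>
  have C2: "C2_closure \<Omega> (\<lambda>x. w x + s) ?D ?D2" for s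
    using C2_closure_add[OF C2_closure_exp[OF C2_closure_scale_norm_sq[of \<Omega> "- \<alpha>" z], of \<kappa>]
        C2_closure_const[of \<Omega> "- \<kappa> * exp (- \<alpha> * R\<^sup>2) + s"]]
    unfolding w_def h_def by (simp add: algebra_simps)
  have F: "F_eq lam x (u x) (?D x) (?D2 x) < 0"
    if x: "R / 2 < norm (x - z)" "u x \<le> w x" for x
  proof -
    have "norm (?D x) = \<kappa> * exp (h x) * (2 * \<alpha> * norm (x - z))"
      using \<kappa> \<alpha> by simp
    moreover have "\<alpha> * R \<le> 2 * \<alpha> * norm (x - z)"
      using mult_left_mono[of "R / 2" "norm (x - z)" "2 * \<alpha>"] x \<alpha> by simp
    with \<alpha>(2) have "lam \<le> 2 * \<alpha> * norm (x - z)" by linarith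
    then have "\<kappa> * exp (h x) * (2 * \<alpha> * norm (x - z)) \<ge> \<kappa> * exp (h x) * lam"
      by (rule mult_left_mono) (use \<kappa> in simp)
    \<comment> \<open>The assumption \<open>u x \<le> w x\<close> enters here: \<open>w\<close> is
      strictly less than its exponential part, which governs the gradient.\<close>
    moreover have "u x < \<kappa> * exp (h x)" using x(2) \<kappa> unfolding w_def by (smt (verit) exp_gt_zero mult_pos_pos)
    then have "lam * u x < \<kappa> * exp (h x) * lam" using \<open>lam > 0\<close> by (simp add: mult.commute)
    ultimately have 1: "norm (?D x) > lam * u x" by linarith
    have "(norm (x - z))\<^sup>2 > (R / 2)\<^sup>2" using x R by (intro power_strict_mono) auto
    then have "(x - z) \<bullet> (x - z) > R\<^sup>2 / 4"
      by (simp add: power2_norm_eq_inner power_divide)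
    then have "\<alpha> * ((x - z) \<bullet> (x - z)) > \<alpha> * (R\<^sup>2 / 4)" using \<alpha>(1) by (rule mult_strict_left_mono)
    then have *: "2 * \<alpha> * ((x - z) \<bullet> (x - z)) > 1" using \<alpha>(3) by linarith
    have "2 * - \<alpha> + (2 * - \<alpha>)\<^sup>2 * ((x - z) \<bullet> (x - z)) = 2 * \<alpha> * (2 * \<alpha> * ((x - z) \<bullet> (x - z)) - 1)"
      by (simp add: algebra_simps power2_eq_square)
    also have "\<dots> > 0" using * \<alpha> by simp
    finally have 2: "2 * - \<alpha> + (2 * - \<alpha>)\<^sup>2 * ((x - z) \<bullet> (x - z)) > 0" .
    have "\<kappa> * exp (h x) > 0" using \<kappa> by simp
    then have "(\<kappa> * exp (h x)) ^ 3 > 0" by (rule zero_less_power)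
    moreover have "(2 * - \<alpha>)\<^sup>2 > 0" using \<alpha>(1) by simp
    moreover have "(x - z) \<bullet> (x - z) > 0" using x(1) R(1) by auto
    ultimately have "infinity_Laplacian (?D x) (?D2 x) > 0"
      unfolding infinity_Laplacian_radial using 2 by (intro mult_pos_pos)
    with 1 show ?thesis unfolding F_eq_def by linarith
  qed
  have "continuous_on (closure \<Omega>) (\<lambda>x. u x - w x)"
    unfolding w_def h_def by (intro continuous_intros cont)
  moreover have "compact (closure \<Omega>)" "closure \<Omega> \<noteq> {}" using \<open>bounded \<Omega>\<close> x0 by auto
  ultimately obtain x1 where x1: "x1 \<in> closure \<Omega>"
    and min1: "\<And>x. x \<in> closure \<Omega> \<Longrightarrow> u x1 - w x1 \<le> u x - w x"
    using continuous_attains_inf[of "closure \<Omega>" "\<lambda>x. u x - w x"] by blast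
  \<comment> \<open>A negative minimum of \<open>u - w\<close> forces
    \<open>w x1 > u x1 \<ge> 0\<close>, so \<open>x1\<close> is in the open ball but not in the
    inner one. There the barrier, shifted to touch \<open>u\<close> at \<open>x1\<close>,
    contradicts \<open>F\<close>.\<close>
  have below: "w x \<le> u x" if x: "x \<in> closure \<Omega>" for x
  proof (rule ccontr)
    assume "\<not> w x \<le> u x"
    then have neg: "u x1 < w x1" using min1[OF x] by linarith
    then have "w x1 > 0" using nonneg[OF x1] by linarith
    then have "\<alpha> * (norm (x1 - z))\<^sup>2 < \<alpha> * R\<^sup>2" using \<kappa> by (simp add: w_def h)
    then have "norm (x1 - z) < R" using \<alpha> R by (simp add: power_less_imp_less_base)
    then have "x1 \<in> \<Omega>" using ball by (auto simp: dist_norm norm_minus_commute)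
    have "R / 2 < norm (x1 - z)"
    proof (rule ccontr)
      assume "\<not> R / 2 < norm (x1 - z)"
      then have "\<kappa> \<le> u x1" using min2 unfolding \<kappa>_def by (simp add: dist_norm norm_minus_commute)
      moreover have "h x1 \<le> 0" using \<alpha> by (simp add: h)
      then have "\<kappa> * exp (h x1) \<le> \<kappa>" using \<kappa> by simp
      moreover have "\<kappa> * exp (- \<alpha> * R\<^sup>2) > 0" using \<kappa> by simp
      ultimately show False using neg unfolding w_def by linarith
    qed
    from F[OF this] neg have "F_eq lam x1 (u x1) (?D x1) (?D2 x1) < 0" by simp
    moreover have "F_eq lam x1 (u x1) (?D x1) (?D2 x1) \<ge> 0"
      by (rule viscosity_supersolution_touching(1)[OF super x1 C2[of "u x1 - w x1"] _ _ \<open>x1 \<in> \<Omega>\<close>])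
        (use min1 in force)+
    ultimately show False by linarith
  qed
  have w0: "w x0 = 0" by (simp add: w_def h R)
  \<comment> \<open>Now \<open>w\<close> touches \<open>u\<close> at the zero \<open>x0\<close> from
    below. Its gradient there points inward, so both entries of the maximum turn out
    negative.\<close>
  have "max (F_eq lam x0 (u x0) (?D x0) (?D2 x0)) (G_bc \<beta> \<nu> x0 (u x0) (?D x0)) \<ge> 0"
    by (rule viscosity_supersolution_touching(2)[OF super x0 C2[of 0] _ _ x0fr])
      (use below u0 w0 in auto)
  moreover have "F_eq lam x0 (u x0) (?D x0) (?D2 x0) < 0"
    by (rule F) (use R u0 w0 in auto)
  moreover have "(x0 - z) \<bullet> \<nu> x0 > 0"
    using outer_normal_interior_ball[OF assms(1,3) x0fr _ R ball] normal x0fr by blast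
  then have "?D x0 \<bullet> \<nu> x0 < 0" using \<kappa> \<alpha> by (simp add: mult_pos_pos)
  then have "G_bc \<beta> \<nu> x0 (u x0) (?D x0) < 0" unfolding G_bc_def by linarith
  ultimately show False by linarith
qed

lemma supersolution_ge:
  fixes \<Omega> :: "(real^'n) set"
  assumes "open \<Omega>" and "\<Omega> \<noteq> {}" and "bounded \<Omega>" and "lam > 0"
    and cont: "continuous_on (closure \<Omega>) u"
    and super: "viscosity_supersolution \<Omega> (F_eq lam) (G_bc \<beta> \<nu>) u"
    and pos: "\<And>x. x \<in> closure \<Omega> \<Longrightarrow> u x > 0"
  shows "\<beta> \<le> lam"
proof (rule ccontr)
  assume "\<not> \<beta> \<le> lam"
  then obtain c where c: "lam < c" "c < \<beta>" using dense[of lam \<beta>] by auto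
  then obtain p :: "real^'n" where p: "norm p = c"
    using vector_choose_size[of c] \<open>lam > 0\<close> by auto
  have "continuous_on (closure \<Omega>) (\<lambda>x. u x * exp (- (p \<bullet> x)))"
    by (intro continuous_intros cont)
  moreover have "compact (closure \<Omega>)" "closure \<Omega> \<noteq> {}"
    using \<open>bounded \<Omega>\<close> \<open>\<Omega> \<noteq> {}\<close> by auto
  ultimately obtain x0 where x0: "x0 \<in> closure \<Omega>"
    and min0: "\<And>x. x \<in> closure \<Omega> \<Longrightarrow> u x0 * exp (- (p \<bullet> x0)) \<le> u x * exp (- (p \<bullet> x))"
    using continuous_attains_inf[of "closure \<Omega>"] by blast
  \<comment> \<open>The multiple of the exponential given by the least ratio of \<open>u\<close> to
    \<open>exp (p \<bullet> x)\<close>; it lies below \<open>u\<close> and meets it at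
    \<open>x0\<close>.\<close>
  let ?\<phi> = "\<lambda>x. (u x0 * exp (- (p \<bullet> x0))) * exp (p \<bullet> x)"
  have C2: "C2_closure \<Omega> ?\<phi> (\<lambda>x. ?\<phi> x *\<^sub>R p) (\<lambda>x. ?\<phi> x *\<^sub>R (0 + outer_square p))"
    by (rule C2_closure_exp[OF C2_closure_inner])
  have \<phi>0: "?\<phi> x0 = u x0" by (simp add: exp_minus)
  have below: "?\<phi> x \<le> u x" if "x \<in> closure \<Omega>" for x
    using min0[OF that] by (simp add: exp_minus field_simps)
  note touch = viscosity_supersolution_touching[OF super x0 C2 \<phi>0 below, unfolded \<phi>0]
  have u0: "u x0 > 0" using pos x0 .
  have nD: "norm (u x0 *\<^sub>R p) = u x0 * c" using u0 p by simp
  have "p \<bullet> p > 0" using p c \<open>lam > 0\<close> by auto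
  then have "infinity_Laplacian (u x0 *\<^sub>R p) (u x0 *\<^sub>R (0 + outer_square p)) > 0"
    unfolding infinity_Laplacian_linear using u0 by (intro mult_pos_pos zero_less_power)
  then have F: "F_eq lam x0 (u x0) (u x0 *\<^sub>R p) (u x0 *\<^sub>R (0 + outer_square p)) < 0"
    unfolding F_eq_def nD using c u0 by simp
  have "u x0 * c < \<beta> * u x0" using c u0 by simp
  \<comment> \<open>The first entry of the minimum is negative because \<open>c < \<beta>\<close>,
    whatever the normal.\<close>
  then have G: "G_bc \<beta> \<nu> x0 (u x0) (u x0 *\<^sub>R p) < 0" unfolding G_bc_def nD by linarith
  have "x0 \<in> \<Omega> \<or> x0 \<in> frontier \<Omega>"
    using x0 \<open>open \<Omega>\<close> by (auto simp: frontier_def interior_open)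
  then show False
  proof
    assume "x0 \<in> \<Omega>" from touch(1)[OF _ this] F show False by simp
  next
    assume "x0 \<in> frontier \<Omega>" from touch(2)[OF _ this] F G show False by simp
  qed
qed

theorem theorem1p3:
  fixes \<Omega> :: "(real^'n) set" and \<nu> :: "real^'n \<Rightarrow> real^'n"
    and u :: "real^'n \<Rightarrow> real" and \<beta> lam :: real
  assumes "CARD('n) \<ge> 2"
    and "\<beta> > 0"
    and "open \<Omega>" and "connected \<Omega>" and "\<Omega> \<noteq> {}" and "bounded \<Omega>"
    and "C2_boundary \<Omega>"
    and "\<forall>x\<in>frontier \<Omega>. outer_unit_normal \<Omega> x (\<nu> x)"
    and "lam > 0"
    and "positive_eigenfunction \<Omega> \<nu> \<beta> lam u"
  shows "lam = \<beta>"
proof (rule antisym)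
  have u: "continuous_on (closure \<Omega>) u" "viscosity_supersolution \<Omega> (F_eq lam) (G_bc \<beta> \<nu>) u"
    "viscosity_subsolution \<Omega> (F_eq lam) (G_bc \<beta> \<nu>) u" "\<forall>x\<in>\<Omega>. u x > 0"
    using assms(10) unfolding positive_eigenfunction_def viscosity_solution_def by auto
  show "lam \<le> \<beta>"
    using assms(3,5,6,7,8,2) u(1,3,4) by (rule subsolution_le)
  \<comment> \<open>Positivity is given only inside \<open>\<Omega>\<close>; Hopf's lemma carries it
    to the boundary, where the exponential may touch.\<close>
  have "u x > 0" if "x \<in> closure \<Omega>" for x
    using assms(3,6,7,8,9) u(1,2,4) that by (rule supersolution_pos_on_closure)
  with assms(3,5,6,9) u(1,2) show "\<beta> \<le> lam" by (rule supersolution_ge)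
qed

end
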